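(* Let $G$ be an $(n,d,\lambda)$-graph with vertex set $V$. For every set of vertices $E\subseteq V$, \[ \left| p_2(E) - \left(\frac{d}{n}\right)^2 |E|^3 \right| \leqslant 2\,\frac{\lambda d}{n}\,|E|^2 + \lambda^2 |E|, \] where $p_2(E)$ is the number of ordered triples $(u,v,w)\in E\times E\times E$ such that $uv$ and $vw$ are both edges of $G$. In particular, if $|E| \gg \lambda \frac{n}{d}$ (i.e. $|E|\,d/(\lambda n)\to\infty$), then \[ p_2(E) = (1+o(1))\,|E|^3\left(\frac{d}{n}\right)^2 . \]
   Context: A graph is an $(n,d,\lambda)$-graph if it is a $d$-regular graph on $n$ vertices such that every eigenvalue of its adjacency matrix other than the largest one has absolute value at most $\lambda$. *)

theory Defs
  imports
    "Graph_Theory.Pair_Digraph"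
    "Jordan_Normal_Form.Char_Poly"
    "HOL-Library.Landau_Symbols"
begin

text \<open>
  A finite simple graph is a \<^locale>\<open>pair_graph\<close>: a finite vertex set with a symmetric irreflexive
  set of ordered pairs, so an undirected edge \<open>uv\<close> is represented by both \<open>(u, v)\<close> and \<open>(v, u)\<close>.
\<close>

definition vertex_enum :: "'a pair_pre_digraph \<Rightarrow> 'a list" where
  "vertex_enum G = (SOME vs. distinct vs \<and> set vs = pverts G)"

definition adjacency_matrix :: "'a pair_pre_digraph \<Rightarrow> real mat" where
  "adjacency_matrix G =
     (let vs = vertex_enum G
      in mat (length vs) (length vs)
           (\<lambda>(i, j). if (vs ! i, vs ! j) \<in> parcs G then 1 else 0))"

text \<open>
  The eigenvalues with multiplicity. They do not depend on the chosen enumeration of the vertices,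
  and since the adjacency matrix is real symmetric, all of its eigenvalues are real; thus this
  multiset has as many elements as the graph has vertices.
\<close>

definition adjacency_eigenvalues :: "'a pair_pre_digraph \<Rightarrow> real multiset" where
  "adjacency_eigenvalues G = proots (char_poly (adjacency_matrix G))"

text \<open>
  Only one copy of the largest eigenvalue is exempt from the bound: if the largest eigenvalue is
  repeated, the remaining copies have to be bounded by \<open>lam\<close> as well.
\<close>

locale ndl_graph = pair_graph G
  for G :: "'a pair_pre_digraph" and n d :: nat and lam :: real +
  assumes card_verts: "card (pverts G) = n"
    and regular: "\<And>v. v \<in> pverts G \<Longrightarrow> out_degree (with_proj G) v = d"
    and eigenvalue_bound:
      "\<And>x. x \<in># adjacency_eigenvalues G - {#Max_mset (adjacency_eigenvalues G)#} \<Longrightarrow> \<bar>x\<bar> \<le> lam"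

text \<open>The endpoints \<open>u\<close> and \<open>w\<close> are allowed to coincide.\<close>

definition p2 :: "'a pair_pre_digraph \<Rightarrow> 'a set \<Rightarrow> nat" where
  "p2 G E = card {(u, v, w). u \<in> E \<and> v \<in> E \<and> w \<in> E \<and> (u, v) \<in> parcs G \<and> (v, w) \<in> parcs G}"

end

theory Submission
  imports Defs "HOL-Analysis.Function_Topology" "HOL-Analysis.Convex"
begin

text \<open>
  Write the indicator of \<open>E\<close> as \<open>|E|/n + y\<close> with \<open>y\<close> of sum zero. For the adjacency operator \<open>A\<close>,
  the number of neighbours of \<open>v\<close> in \<open>E\<close> is then \<open>d|E|/n + (A y) v\<close>, and \<open>p\<^sub>2(E)\<close> is the sum of its
  squares over \<open>v \<in> E\<close>. Expanding the square leaves the main term, a cross term, which is controlled by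
  the Cauchy-Schwarz inequality, and a part of \<open>\<parallel>A y\<parallel>\<^sup>2\<close>; both errors need only
  \<open>\<parallel>A y\<parallel> \<le> lam \<parallel>y\<parallel>\<close>. The norm of \<open>A\<close> on sum-zero functions is attained by compactness, at
  an eigenvector orthogonal to the constants. Its eigenvalue is not the exempt copy of the largest
  eigenvalue \<open>d\<close>: if it equals \<open>d\<close>, then \<open>d\<close> is a root of multiplicity at least two.
\<close>

section \<open>Symmetric kernels acting on functions\<close>

text \<open>The matrix is kept as a function on pairs of points, so that the analytic part of the
  argument needs no enumeration of \<open>V\<close>. Only the values of \<open>x\<close> on
  \<open>V\<close> enter.\<close>

definition kernel_op :: "'a set \<Rightarrow> ('a \<Rightarrow> 'a \<Rightarrow> real) \<Rightarrow> ('a \<Rightarrow> real) \<Rightarrow> 'a \<Rightarrow> real" where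
  "kernel_op V K x v = (\<Sum>w\<in>V. K v w * x w)"

lemma kernel_op_add: "kernel_op V K (\<lambda>v. x v + y v) v = kernel_op V K x v + kernel_op V K y v"
  by (simp add: kernel_op_def algebra_simps sum.distrib)

lemma kernel_op_scale: "kernel_op V K (\<lambda>v. c * x v) v = c * kernel_op V K x v"
  by (simp add: kernel_op_def algebra_simps sum_distrib_left)

lemma kernel_op_cong:
  assumes "\<And>w. w \<in> V \<Longrightarrow> x w = y w"
  shows "kernel_op V K x v = kernel_op V K y v"
  using assms by (simp add: kernel_op_def)

lemma kernel_op_self_adjoint:
  assumes "\<And>v w. v \<in> V \<Longrightarrow> w \<in> V \<Longrightarrow> K v w = K w v"
  shows "(\<Sum>v\<in>V. kernel_op V K x v * y v) = (\<Sum>v\<in>V. x v * kernel_op V K y v)"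
proof -
  have "(\<Sum>v\<in>V. kernel_op V K x v * y v) = (\<Sum>v\<in>V. \<Sum>w\<in>V. K v w * x w * y v)"
    by (simp add: kernel_op_def sum_distrib_right)
  also have "\<dots> = (\<Sum>w\<in>V. \<Sum>v\<in>V. K v w * x w * y v)"
    by (rule sum.swap)
  also have "\<dots> = (\<Sum>w\<in>V. x w * kernel_op V K y w)"
    unfolding kernel_op_def sum_distrib_left
    by (intro sum.cong refl) (use assms in \<open>simp add: mult_ac\<close>)
  finally show ?thesis .
qed

text \<open>Self-adjointness moves the operator onto the constant function 1, which it multiplies by
  \<open>d\<close>. Hence the operator maps sum-zero functions to sum-zero functions.\<close>

lemma sum_kernel_op:
  assumes "\<And>v w. v \<in> V \<Longrightarrow> w \<in> V \<Longrightarrow> K v w = K w v"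
    and "\<And>v. v \<in> V \<Longrightarrow> (\<Sum>w\<in>V. K v w) = d"
  shows "(\<Sum>v\<in>V. kernel_op V K x v) = d * (\<Sum>v\<in>V. x v)"
proof -
  have "(\<Sum>v\<in>V. kernel_op V K x v * 1) = (\<Sum>v\<in>V. x v * kernel_op V K (\<lambda>_. 1) v)"
    using assms(1) by (rule kernel_op_self_adjoint)
  also have "\<dots> = (\<Sum>v\<in>V. x v * d)"
    using assms(2) by (intro sum.cong refl) (simp add: kernel_op_def)
  finally show ?thesis by (simp add: sum_distrib_left mult.commute)
qed

section \<open>The extremal problem on sum-zero functions\<close>

text \<open>Vanishing off \<open>V\<close> and having norm 1 confine \<open>x\<close> to a product
  of intervals and singletons, which is compact in the product topology by Tychonoff's theorem. The
  two equations are closed conditions because they involve only finitely many coordinates.\<close>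

lemma compact_balanced_sphere:
  assumes "finite V"
  shows "compact {x :: 'a \<Rightarrow> real. (\<forall>v. v \<notin> V \<longrightarrow> x v = 0) \<and> (\<Sum>v\<in>V. x v) = 0 \<and> (\<Sum>v\<in>V. (x v)\<^sup>2) = 1}"
    (is "compact ?S")
proof -
  define B :: "('a \<Rightarrow> real) set" where "B = PiE UNIV (\<lambda>v. if v \<in> V then {-1..1} else {0})"
  have "compactin (product_topology (\<lambda>_. euclidean) UNIV) B"
    unfolding B_def compactin_PiE by (auto simp: compactin_euclidean_iff)
  then have B: "compact B"
    by (simp add: euclidean_product_topology compactin_euclidean_iff)
  have "closed {x :: 'a \<Rightarrow> real. (\<Sum>v\<in>V. x v) = 0}" "closed {x :: 'a \<Rightarrow> real. (\<Sum>v\<in>V. (x v)\<^sup>2) = 1}"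
    by (intro closed_Collect_eq continuous_intros continuous_on_product_coordinates)+
  then have "compact (B \<inter> ({x. (\<Sum>v\<in>V. x v) = 0} \<inter> {x. (\<Sum>v\<in>V. (x v)\<^sup>2) = 1}))"
    by (intro compact_Int_closed B closed_Int)
  moreover have "?S = B \<inter> ({x. (\<Sum>v\<in>V. x v) = 0} \<inter> {x. (\<Sum>v\<in>V. (x v)\<^sup>2) = 1})"
  proof -
    have "x \<in> B" if "\<forall>v. v \<notin> V \<longrightarrow> x v = 0" "(\<Sum>v\<in>V. (x v)\<^sup>2) = 1" for x
    proof -
      have "\<bar>x v\<bar> \<le> 1" if "v \<in> V" for v
      proof -
        have "(x v)\<^sup>2 \<le> (\<Sum>v\<in>V. (x v)\<^sup>2)"
          using assms that by (intro member_le_sum) auto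
        then show ?thesis
          using \<open>(\<Sum>v\<in>V. (x v)\<^sup>2) = 1\<close> by (simp add: abs_square_le_1)
      qed
      then show ?thesis using that by (auto simp: B_def PiE_UNIV_domain abs_le_iff minus_le_iff)
    qed
    moreover have "\<forall>v. v \<notin> V \<longrightarrow> x v = 0" if "x \<in> B" for x
      using that by (auto simp: B_def PiE_UNIV_domain Pi_iff split: if_splits)
    ultimately show ?thesis by auto
  qed
  ultimately show ?thesis by simp
qed

text \<open>Provides the nonemptiness of the sphere on which a maximum is sought; this is where two
  points of \<open>V\<close> are used.\<close>

lemma ex_balanced_unit:
  assumes "finite V" "2 \<le> card V"
  obtains x :: "'a \<Rightarrow> real" where "\<And>v. v \<notin> V \<Longrightarrow> x v = 0" "(\<Sum>v\<in>V. x v) = 0" "(\<Sum>v\<in>V. (x v)\<^sup>2) = 1"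
proof -
  obtain a b where ab: "a \<in> V" "b \<in> V" "a \<noteq> b"
    using assms by (metis card_le_Suc0_iff_eq not_less_eq_eq numeral_2_eq_2)
  define x :: "'a \<Rightarrow> real" where
    "x v = (if v = a then 1 / sqrt 2 else 0) + (if v = b then - 1 / sqrt 2 else 0)" for v
  have "(x v)\<^sup>2 = (if v = a then 1 / 2 else 0) + (if v = b then 1 / 2 else 0)" for v
    using ab by (auto simp: x_def power_divide)
  then have "(\<Sum>v\<in>V. (x v)\<^sup>2) = 1"
    using assms ab by (simp add: sum.distrib)
  moreover have "(\<Sum>v\<in>V. x v) = 0"
    using assms ab by (simp add: x_def sum.distrib)
  ultimately show ?thesis
    using ab by (intro that[of x]) (auto simp: x_def)
qed

lemma ex_balanced_maximizer:
  fixes K :: "'a \<Rightarrow> 'a \<Rightarrow> real"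
  assumes "finite V" "2 \<le> card V"
  obtains x where "(\<Sum>v\<in>V. x v) = 0" "(\<Sum>v\<in>V. (x v)\<^sup>2) = 1"
    "\<And>y. (\<Sum>v\<in>V. y v) = 0 \<Longrightarrow>
      (\<Sum>v\<in>V. (kernel_op V K y v)\<^sup>2) \<le> (\<Sum>v\<in>V. (kernel_op V K x v)\<^sup>2) * (\<Sum>v\<in>V. (y v)\<^sup>2)"
proof -
  let ?S = "{x :: 'a \<Rightarrow> real. (\<forall>v. v \<notin> V \<longrightarrow> x v = 0) \<and> (\<Sum>v\<in>V. x v) = 0 \<and> (\<Sum>v\<in>V. (x v)\<^sup>2) = 1}"
  let ?N = "\<lambda>x. \<Sum>v\<in>V. (kernel_op V K x v)\<^sup>2"
  have "continuous_on ?S ?N"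
    unfolding kernel_op_def
    by (intro continuous_intros continuous_on_subset[OF continuous_on_product_coordinates]) auto
  moreover have "?S \<noteq> {}"
    by (rule ex_balanced_unit[OF assms]) blast
  ultimately have "\<exists>x\<in>?S. \<forall>y\<in>?S. ?N y \<le> ?N x"
    by (intro continuous_attains_sup compact_balanced_sphere assms(1))
  then obtain x where x: "x \<in> ?S" "\<And>y. y \<in> ?S \<Longrightarrow> ?N y \<le> ?N x"
    by blast
  have "?N y \<le> ?N x * (\<Sum>v\<in>V. (y v)\<^sup>2)" if y: "(\<Sum>v\<in>V. y v) = 0" for y
  proof -
    define q where "q = (\<Sum>v\<in>V. (y v)\<^sup>2)"
    have "q \<ge> 0" unfolding q_def by (intro sum_nonneg) auto
    show ?thesis
    proof (cases "q = 0")
      case True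
      then have "\<forall>v\<in>V. y v = 0"
        using assms(1) by (simp add: q_def sum_nonneg_eq_0_iff)
      then show ?thesis by (simp add: kernel_op_def)
    next
      case False
      \<comment> \<open>Besides being normalized, \<open>y\<close> is cut off outside
        \<open>V\<close> to land in the compact set; the operator does not see the cut.\<close>
      define z where "z v = (if v \<in> V then (1 / sqrt q) * y v else 0)" for v
      have "z \<in> ?S"
        using False y \<open>q \<ge> 0\<close>
        by (auto simp: z_def power_mult_distrib power_divide simp flip: sum_divide_distrib q_def)
      then have "?N z \<le> ?N x" by (rule x)
      moreover have "kernel_op V K z v = (1 / sqrt q) * kernel_op V K y v" for v
        unfolding kernel_op_scale[symmetric] by (rule kernel_op_cong) (simp add: z_def)
      then have "?N z = ?N y / q"
        using \<open>q \<ge> 0\<close> by (simp add: power_divide sum_divide_distrib)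
      ultimately show ?thesis
        using False \<open>q \<ge> 0\<close> by (simp add: divide_le_eq flip: q_def)
    qed
  qed
  with x(1) show ?thesis by (intro that[of x]) auto
qed

text \<open>The first-order condition at an extremum. For any positive \<open>m\<close> exceeding
  \<open>c\<close>, the value at \<open>t = - b / m\<close> is
  \<open>b\<^sup>2 * (c - m) / m\<^sup>2\<close>, which is negative unless
  \<open>b = 0\<close>.\<close>

lemma linear_term_zero_of_nonneg:
  fixes b c :: real
  assumes "\<And>t. 0 \<le> b * t + c * t\<^sup>2"
  shows "b = 0"
proof (rule ccontr)
  assume "b \<noteq> 0"
  define m where "m = \<bar>c\<bar> + 1"
  have m: "m > 0" "c < m" by (auto simp: m_def)
  have "b * (- b / m) + c * (- b / m)\<^sup>2 = b\<^sup>2 / m\<^sup>2 * (c - m)"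
    using m(1) by (simp add: field_simps power2_eq_square)
  also have "\<dots> < 0"
    using \<open>b \<noteq> 0\<close> m by (intro mult_pos_neg) auto
  finally show False using assms[of "- b / m"] by simp
qed

text \<open>
  A maximizer \<open>x\<close> of \<open>\<parallel>K x\<parallel>\<close> on the unit sphere of the sum-zero space satisfies \<open>K\<^sup>2 x = s\<^sup>2 x\<close>,
  so either \<open>K x = - s x\<close>, or \<open>K x + s x\<close> is an eigenvector for \<open>s\<close>.
\<close>

lemma ex_extremal_balanced_eigenvector:
  fixes K :: "'a \<Rightarrow> 'a \<Rightarrow> real"
  assumes fin: "finite V" and card: "2 \<le> card V"
    and sym: "\<And>v w. v \<in> V \<Longrightarrow> w \<in> V \<Longrightarrow> K v w = K w v"
    and row: "\<And>v. v \<in> V \<Longrightarrow> (\<Sum>w\<in>V. K v w) = d"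
  obtains x \<mu> where "\<exists>v\<in>V. x v \<noteq> 0" "(\<Sum>v\<in>V. x v) = 0"
    "\<And>v. v \<in> V \<Longrightarrow> kernel_op V K x v = \<mu> * x v"
    "\<And>y. (\<Sum>v\<in>V. y v) = 0 \<Longrightarrow> (\<Sum>v\<in>V. (kernel_op V K y v)\<^sup>2) \<le> \<mu>\<^sup>2 * (\<Sum>v\<in>V. (y v)\<^sup>2)"
proof -
  let ?A = "kernel_op V K"
  obtain x where x0: "(\<Sum>v\<in>V. x v) = 0" and x1: "(\<Sum>v\<in>V. (x v)\<^sup>2) = 1"
    and max: "\<And>y. (\<Sum>v\<in>V. y v) = 0 \<Longrightarrow> (\<Sum>v\<in>V. (?A y v)\<^sup>2) \<le> (\<Sum>v\<in>V. (?A x v)\<^sup>2) * (\<Sum>v\<in>V. (y v)\<^sup>2)"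
    using ex_balanced_maximizer[OF fin card, of K] by blast
  define S where "S = (\<Sum>v\<in>V. (?A x v)\<^sup>2)"
  have "S \<ge> 0" unfolding S_def by (intro sum_nonneg) auto
  define r where "r v = S * x v - ?A (?A x) v" for v
  have Ax0: "(\<Sum>v\<in>V. ?A x v) = 0"
    using sum_kernel_op[of V K d x] sym row x0 by simp
  have r0: "(\<Sum>v\<in>V. r v) = 0"
    using sum_kernel_op[of V K d "?A x"] sym row x0 Ax0 by (simp add: r_def sum_subtractf flip: sum_distrib_left)
  have cross: "(\<Sum>v\<in>V. ?A x v * ?A r v) = (\<Sum>v\<in>V. ?A (?A x) v * r v)"
    by (rule kernel_op_self_adjoint[symmetric]) (rule sym)
  have rr: "S * (\<Sum>v\<in>V. x v * r v) - (\<Sum>v\<in>V. ?A x v * ?A r v) = (\<Sum>v\<in>V. (r v)\<^sup>2)"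
    unfolding cross sum_distrib_left sum_subtractf[symmetric]
    by (intro sum.cong refl) (simp add: r_def power2_eq_square algebra_simps)
  \<comment> \<open>Along \<open>x + t * r\<close> this quadratic form is nonnegative by maximality
    and vanishes at \<open>t = 0\<close>; by \<open>rr\<close> its linear coefficient in
    \<open>t\<close> is twice the squared norm of \<open>r\<close>.\<close>
  have "2 * (\<Sum>v\<in>V. (r v)\<^sup>2) = 0"
  proof (rule linear_term_zero_of_nonneg)
    fix t :: real
    have "(\<Sum>v\<in>V. x v + t * r v) = 0"
      using x0 r0 by (simp add: sum.distrib flip: sum_distrib_left)
    from max[OF this]
    have "(\<Sum>v\<in>V. (?A x v + t * ?A r v)\<^sup>2) \<le> S * (\<Sum>v\<in>V. (x v + t * r v)\<^sup>2)"
      by (simp add: kernel_op_add kernel_op_scale flip: S_def)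
    moreover have expand: "(\<Sum>v\<in>V. (f v + t * g v)\<^sup>2) =
        (\<Sum>v\<in>V. (f v)\<^sup>2) + 2 * t * (\<Sum>v\<in>V. f v * g v) + t\<^sup>2 * (\<Sum>v\<in>V. (g v)\<^sup>2)" for f g :: "'a \<Rightarrow> real"
      by (simp add: power2_sum power_mult_distrib sum.distrib sum_distrib_left mult_ac)
    ultimately have "0 \<le> 2 * t * (S * (\<Sum>v\<in>V. x v * r v) - (\<Sum>v\<in>V. ?A x v * ?A r v))
        + t\<^sup>2 * (S * (\<Sum>v\<in>V. (r v)\<^sup>2) - (\<Sum>v\<in>V. (?A r v)\<^sup>2))"
      unfolding expand x1 S_def[symmetric] by (simp add: algebra_simps)
    then show "0 \<le> 2 * (\<Sum>v\<in>V. (r v)\<^sup>2) * t + (S * (\<Sum>v\<in>V. (r v)\<^sup>2) - (\<Sum>v\<in>V. (?A r v)\<^sup>2)) * t\<^sup>2"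
      unfolding rr by (simp add: mult_ac)
  qed
  then have r: "r v = 0" if "v \<in> V" for v
    using fin that by (simp add: sum_nonneg_eq_0_iff)
  define s where "s = sqrt S"
  have ss: "s * s = S" using \<open>S \<ge> 0\<close> by (simp add: s_def)
  have bound: "(\<Sum>v\<in>V. (?A y v)\<^sup>2) \<le> s\<^sup>2 * (\<Sum>v\<in>V. (y v)\<^sup>2)" if "(\<Sum>v\<in>V. y v) = 0" for y
    using max[OF that] by (simp add: S_def power2_eq_square ss)
  define z where "z v = ?A x v + s * x v" for v
  show ?thesis
  proof (cases "\<exists>v\<in>V. z v \<noteq> 0")
    case True
    show ?thesis
    proof (rule that[of z s])
      show "(\<Sum>v\<in>V. z v) = 0"
        using x0 Ax0 by (simp add: z_def sum.distrib flip: sum_distrib_left)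
      show "?A z v = s * z v" if "v \<in> V" for v
        using r[OF that] unfolding z_def kernel_op_add kernel_op_scale r_def
        by (simp add: algebra_simps flip: ss)
    qed (use True bound in auto)
  next
    case False
    show ?thesis
    proof (rule that[of x "- s"])
      show "\<exists>v\<in>V. x v \<noteq> 0"
      proof (rule ccontr)
        assume "\<not> ?thesis"
        then have "(\<Sum>v\<in>V. (x v)\<^sup>2) = 0" by simp
        with x1 show False by simp
      qed
      show "?A x v = - s * x v" if "v \<in> V" for v
        using False that by (auto simp: z_def)
      show "(\<Sum>v\<in>V. (?A y v)\<^sup>2) \<le> (- s)\<^sup>2 * (\<Sum>v\<in>V. (y v)\<^sup>2)" if "(\<Sum>v\<in>V. y v) = 0" for y
        using bound[OF that] by simp
    qed (rule x0)
  qed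
qed

section \<open>Multiple roots of characteristic polynomials\<close>

text \<open>If p = (X - a) q, then the derivative of p takes the value q(a) at a, so a second factor
  X - a splits off.\<close>

lemma two_le_order_if_pderiv_root:
  fixes p :: "'a :: idom poly"
  assumes "p \<noteq> 0" "poly p a = 0" "poly (pderiv p) a = 0"
  shows "2 \<le> order a p"
proof -
  obtain q where q: "p = [:- a, 1:] * q"
    using assms(2) by (auto simp: poly_eq_0_iff_dvd)
  have "poly q a = 0"
    using assms(3) unfolding q pderiv_mult by (simp add: pderiv_pCons)
  then obtain r where r: "q = [:- a, 1:] * r"
    by (auto simp: poly_eq_0_iff_dvd)
  have "[:- a, 1:] ^ 2 dvd p"
    unfolding q r by (simp add: power2_eq_square mult.assoc[symmetric] del: mult_pCons_left)
  then show ?thesis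
    using assms(1) by (simp add: order_max)
qed

lemma mult_mat_vec_index_sum:
  assumes "A \<in> carrier_mat n n" "v \<in> carrier_vec n" "i < n"
  shows "(A *\<^sub>v v) $ i = (\<Sum>j<n. A $$ (i, j) * v $ j)"
  using assms by (auto simp: scalar_prod_def lessThan_atLeast0)

lemma bij_betw_insert_index:
  assumes "i < n"
  shows "bij_betw (insert_index i) {..<n - 1} ({..<n} - {i})"
proof (rule bij_betw_byWitness[where f' = "delete_index i"])
  show "\<forall>j\<in>{..<n} - {i}. insert_index i (delete_index i j) = j"
    by (auto intro: insert_delete_index)
  show "insert_index i ` {..<n - 1} \<subseteq> {..<n} - {i}"
    using assms by (auto simp: insert_index_def split: if_splits)
  show "delete_index i ` ({..<n} - {i}) \<subseteq> {..<n - 1}"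
    using assms by (auto simp: delete_index_def split: if_splits)
qed simp

text \<open>Coordinate \<open>i\<close> contributes nothing to the product of \<open>A\<close> and
  \<open>v\<close>, so the eigenvalue equation survives at the remaining coordinates. The shortened
  vector is nonzero because the only entry dropped is zero.\<close>

lemma eigenvalue_mat_delete:
  fixes A :: "'a :: comm_ring_1 mat"
  assumes A: "A \<in> carrier_mat n n" and i: "i < n"
    and ev: "eigenvector A v k" and vi: "v $ i = 0"
  shows "eigenvalue (mat_delete A i i) k"
proof -
  let ?I = "insert_index i"
  define w where "w = vec (n - 1) (\<lambda>r. v $ ?I r)"
  have v: "v \<in> carrier_vec n" "v \<noteq> 0\<^sub>v n" "A *\<^sub>v v = k \<cdot>\<^sub>v v"
    using ev A by (auto simp: eigenvector_def)
  have less: "?I r < n" if "r < n - 1" for r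
    using that i by (auto simp: insert_index_def)
  have D: "mat_delete A i i \<in> carrier_mat (n - 1) (n - 1)"
    using A by (rule mat_delete_carrier)
  have "mat_delete A i i *\<^sub>v w = k \<cdot>\<^sub>v w"
  proof (rule eq_vecI)
    fix r assume "r < dim_vec (k \<cdot>\<^sub>v w)"
    then have r: "r < n - 1" by (simp add: w_def)
    have "(mat_delete A i i *\<^sub>v w) $ r = (\<Sum>s<n - 1. mat_delete A i i $$ (r, s) * w $ s)"
      using D r by (intro mult_mat_vec_index_sum) (auto simp: w_def)
    also have "\<dots> = (\<Sum>s<n - 1. A $$ (?I r, ?I s) * v $ ?I s)"
    proof (intro sum.cong refl)
      fix s assume "s \<in> {..<n - 1}"
      then show "mat_delete A i i $$ (r, s) * w $ s = A $$ (?I r, ?I s) * v $ ?I s"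
        using A r by (simp add: mat_delete_def w_def insert_index_def)
    qed
    also have "\<dots> = (\<Sum>j\<in>{..<n} - {i}. A $$ (?I r, j) * v $ j)"
      by (rule sum.reindex_bij_betw[OF bij_betw_insert_index[OF i]])
    also have "\<dots> = (\<Sum>j<n. A $$ (?I r, j) * v $ j)"
      using i vi by (simp add: sum.remove[of "{..<n}" i])
    also have "\<dots> = (A *\<^sub>v v) $ ?I r"
      using A v(1) less[OF r] by (intro mult_mat_vec_index_sum[symmetric])
    also have "\<dots> = (k \<cdot>\<^sub>v w) $ r"
      using v r less[OF r] by (simp add: w_def)
    finally show "(mat_delete A i i *\<^sub>v w) $ r = (k \<cdot>\<^sub>v w) $ r" .
  qed (use D in \<open>auto simp: w_def\<close>)
  moreover have "w \<noteq> 0\<^sub>v (n - 1)"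
  proof
    assume w0: "w = 0\<^sub>v (n - 1)"
    have "v $ j = 0" if "j < n" for j
    proof (cases "j = i")
      case False
      then have "j \<in> ?I ` {..<n - 1}"
        using bij_betw_insert_index[OF i] that by (auto simp: bij_betw_def)
      then obtain r where "r < n - 1" "j = ?I r" by auto
      then show ?thesis using arg_cong[OF w0, of "\<lambda>u. u $ r"] by (simp add: w_def)
    qed (use vi in simp)
    then have "v = 0\<^sub>v n" using v(1) by (intro eq_vecI) auto
    with v(2) show False by simp
  qed
  ultimately show ?thesis
    using D unfolding eigenvalue_def eigenvector_def by (intro exI[of _ w]) (auto simp: w_def)
qed

lemma char_poly_nonzero:
  fixes A :: "'a :: idom mat"
  assumes "A \<in> carrier_mat n n"
  shows "char_poly A \<noteq> 0"
  using degree_monic_char_poly[OF assms] by auto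

text \<open>
  The derivative of the characteristic polynomial is the sum of those of the matrices
  \<open>mat_delete A i i\<close>, and for each \<open>i\<close> the span of \<open>u\<close> and \<open>v\<close> contains an eigenvector that
  vanishes at \<open>i\<close>.
\<close>

lemma two_le_order_char_poly:
  fixes A :: "'a :: field mat"
  assumes A: "A \<in> carrier_mat n n" and u: "eigenvector A u k" and v: "eigenvector A v k"
    and indep: "\<And>a b. a \<cdot>\<^sub>v u + b \<cdot>\<^sub>v v = 0\<^sub>v n \<Longrightarrow> b = 0"
  shows "2 \<le> order k (char_poly A)"
proof (rule two_le_order_if_pderiv_root)
  show "char_poly A \<noteq> 0" by (rule char_poly_nonzero[OF A])
  show "poly (char_poly A) k = 0"
    using u A by (auto simp: eigenvalue_def simp flip: eigenvalue_root_char_poly)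
  have "poly (char_poly (mat_delete A i i)) k = 0" if i: "i < n" for i
  proof -
    have uv: "u \<in> carrier_vec n" "A *\<^sub>v u = k \<cdot>\<^sub>v u" "v \<in> carrier_vec n" "A *\<^sub>v v = k \<cdot>\<^sub>v v"
      using u v A by (auto simp: eigenvector_def)
    have "\<exists>z. eigenvector A z k \<and> z $ i = 0"
    proof (cases "u $ i = 0")
      case False
      \<comment> \<open>The combination is chosen to cancel at \<open>i\<close>; it is nonzero by
        independence, since the coefficient of \<open>v\<close> is the nonzero number
        \<open>u $ i\<close>.\<close>
      define z where "z = (- (v $ i)) \<cdot>\<^sub>v u + (u $ i) \<cdot>\<^sub>v v"
      have "z \<noteq> 0\<^sub>v n" using False indep by (auto simp: z_def)
      moreover have "A *\<^sub>v z = k \<cdot>\<^sub>v z"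
        unfolding z_def using uv A
        by (simp add: mult_add_distrib_mat_vec[of A n n] mult_mat_vec[of A n n] smult_add_distrib_vec[of _ n]
            smult_smult_assoc mult.commute)
      moreover have "z \<in> carrier_vec n" "z $ i = 0"
        using uv i by (auto simp: z_def)
      ultimately show ?thesis using A by (auto simp: eigenvector_def)
    qed (use u in auto)
    then have "eigenvalue (mat_delete A i i) k"
      using eigenvalue_mat_delete[OF A i] by blast
    then show ?thesis
      using eigenvalue_root_char_poly[OF mat_delete_carrier[OF A]] by simp
  qed
  then show "poly (pderiv (char_poly A)) k = 0"
    by (simp add: pderiv_char_poly[OF A] poly_sum)
qed

text \<open>The eigenvalue equation is read at a coordinate where the eigenvector has its largest
  absolute value \<open>m\<close>: there the left side is at most the row sum times
  \<open>m\<close>, and \<open>m\<close> is positive.\<close>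

lemma abs_eigenvalue_le_row_sum:
  fixes A :: "real mat"
  assumes A: "A \<in> carrier_mat n n" and nonneg: "\<And>i j. i < n \<Longrightarrow> j < n \<Longrightarrow> 0 \<le> A $$ (i, j)"
    and row: "\<And>i. i < n \<Longrightarrow> (\<Sum>j<n. A $$ (i, j)) = d"
    and ev: "eigenvalue A k"
  shows "\<bar>k\<bar> \<le> d"
proof -
  obtain v where v: "v \<in> carrier_vec n" "v \<noteq> 0\<^sub>v n" "A *\<^sub>v v = k \<cdot>\<^sub>v v"
    using ev A by (auto simp: eigenvalue_def eigenvector_def)
  have "\<exists>j<n. v $ j \<noteq> 0"
  proof (rule ccontr)
    assume "\<not> ?thesis"
    then have "v = 0\<^sub>v n" using v(1) by (intro eq_vecI) auto
    with v(2) show False by simp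
  qed
  then obtain j where j: "j < n" "v $ j \<noteq> 0" by blast
  define m where "m = Max ((\<lambda>j. \<bar>v $ j\<bar>) ` {..<n})"
  have "m \<in> (\<lambda>j. \<bar>v $ j\<bar>) ` {..<n}"
    unfolding m_def using j by (intro Max_in) auto
  then obtain i where i: "i < n" "m = \<bar>v $ i\<bar>" by auto
  have max: "\<bar>v $ j\<bar> \<le> m" if "j < n" for j
    unfolding m_def using that by (intro Max_ge) auto
  have "\<bar>k\<bar> * m = \<bar>(A *\<^sub>v v) $ i\<bar>"
    using v i by (simp add: abs_mult)
  also have "\<dots> = \<bar>\<Sum>j<n. A $$ (i, j) * v $ j\<bar>"
    using A v(1) i(1) by (simp only: mult_mat_vec_index_sum)
  also have "\<dots> \<le> (\<Sum>j<n. A $$ (i, j) * m)"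
    using nonneg i max by (intro sum_abs[THEN order_trans] sum_mono) (auto simp: abs_mult intro!: mult_left_mono)
  also have "\<dots> = d * m"
    using row[OF i(1)] by (simp flip: sum_distrib_right)
  finally show ?thesis
    using max[OF j(1)] j(2) by (simp add: mult_le_cancel_right)
qed

section \<open>The adjacency spectrum of a regular graph\<close>

definition adjacency :: "'a pair_pre_digraph \<Rightarrow> 'a \<Rightarrow> 'a \<Rightarrow> real" where
  "adjacency G v w = of_bool ((v, w) \<in> parcs G)"

context ndl_graph
begin

lemma set_vertex_enum: "set (vertex_enum G) = pverts G"
  and distinct_vertex_enum: "distinct (vertex_enum G)"
  using someI_ex[OF finite_distinct_list[OF pair_finite_verts]]
  unfolding vertex_enum_def by (auto simp: conj_commute)

lemma length_vertex_enum: "length (vertex_enum G) = n"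
  using distinct_card[OF distinct_vertex_enum] by (simp add: set_vertex_enum card_verts)

lemma sum_vertex_enum: "(\<Sum>i<n. f (vertex_enum G ! i)) = (\<Sum>v\<in>pverts G. f v)"
  by (rule sum.reindex_bij_betw, rule bij_betw_nth)
    (simp_all add: distinct_vertex_enum set_vertex_enum length_vertex_enum)

lemma vertex_enum_nth: "i < n \<Longrightarrow> vertex_enum G ! i \<in> pverts G"
  using nth_mem[of i "vertex_enum G"] by (simp add: set_vertex_enum length_vertex_enum)

lemma adjacency_matrix_carrier: "adjacency_matrix G \<in> carrier_mat n n"
  by (simp add: adjacency_matrix_def Let_def length_vertex_enum)

lemma adjacency_matrix_index:
  "i < n \<Longrightarrow> j < n \<Longrightarrow> adjacency_matrix G $$ (i, j) = adjacency G (vertex_enum G ! i) (vertex_enum G ! j)"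
  by (simp add: adjacency_matrix_def Let_def length_vertex_enum adjacency_def)

lemma adjacency_sym: "adjacency G v w = adjacency G w v"
  using pair_sym_arcs by (auto simp: adjacency_def symmetric_def sym_def)

lemma sum_adjacency:
  assumes "E \<subseteq> pverts G"
  shows "(\<Sum>w\<in>E. adjacency G v w) = card {w \<in> E. (v, w) \<in> parcs G}"
  using finite_subset[OF assms pair_finite_verts]
  by (simp add: adjacency_def Int_def flip: of_nat_sum sum.inter_filter)

lemma adjacency_row_sum:
  assumes "v \<in> pverts G"
  shows "(\<Sum>w\<in>pverts G. adjacency G v w) = d"
proof -
  have "out_arcs (with_proj G) v = Pair v ` {w \<in> pverts G. (v, w) \<in> parcs G}"
    using arc_snd_in_verts by (force simp: out_arcs_def)
  then have "d = card (Pair v ` {w \<in> pverts G. (v, w) \<in> parcs G})"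
    using regular[OF assms] by (simp add: out_degree_def)
  then show ?thesis
    by (simp add: sum_adjacency card_image inj_on_def)
qed

text \<open>The bridge from functions on vertices to the matrix whose spectrum the locale
  constrains: \<open>vertex_enum G\<close> turns sums over vertices into sums over indices.\<close>

lemma eigenvector_adjacency_matrix:
  assumes "\<exists>v\<in>pverts G. x v \<noteq> 0"
    and "\<And>v. v \<in> pverts G \<Longrightarrow> kernel_op (pverts G) (adjacency G) x v = k * x v"
  shows "eigenvector (adjacency_matrix G) (vec n (\<lambda>i. x (vertex_enum G ! i))) k"
proof -
  let ?x = "vec n (\<lambda>i. x (vertex_enum G ! i))"
  obtain i where i: "i < n" "x (vertex_enum G ! i) \<noteq> 0"
    using assms(1) by (metis in_set_conv_nth set_vertex_enum length_vertex_enum)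
  then have "?x \<noteq> 0\<^sub>v n" by (auto dest: arg_cong[of _ _ "\<lambda>u. u $ i"])
  moreover have "adjacency_matrix G *\<^sub>v ?x = k \<cdot>\<^sub>v ?x"
  proof (rule eq_vecI)
    fix i assume "i < dim_vec (k \<cdot>\<^sub>v ?x)"
    then have i: "i < n" by simp
    have "(adjacency_matrix G *\<^sub>v ?x) $ i = (\<Sum>j<n. adjacency_matrix G $$ (i, j) * ?x $ j)"
      using adjacency_matrix_carrier i by (intro mult_mat_vec_index_sum) auto
    also have "\<dots> = (\<Sum>j<n. adjacency G (vertex_enum G ! i) (vertex_enum G ! j) * x (vertex_enum G ! j))"
      using i by (intro sum.cong) (auto simp: adjacency_matrix_index)
    also have "\<dots> = kernel_op (pverts G) (adjacency G) x (vertex_enum G ! i)"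
      unfolding kernel_op_def by (rule sum_vertex_enum)
    also have "\<dots> = (k \<cdot>\<^sub>v ?x) $ i"
      using i by (simp add: assms(2) vertex_enum_nth)
    finally show "(adjacency_matrix G *\<^sub>v ?x) $ i = (k \<cdot>\<^sub>v ?x) $ i" .
  qed (use adjacency_matrix_carrier in auto)
  ultimately show ?thesis
    using adjacency_matrix_carrier by (auto simp: eigenvector_def)
qed

lemma count_adjacency_eigenvalues:
  "count (adjacency_eigenvalues G) k = order k (char_poly (adjacency_matrix G))"
  using char_poly_nonzero[OF adjacency_matrix_carrier] by (simp add: adjacency_eigenvalues_def)

lemma in_adjacency_eigenvalues_iff:
  "k \<in># adjacency_eigenvalues G \<longleftrightarrow> eigenvalue (adjacency_matrix G) k"
  using char_poly_nonzero[OF adjacency_matrix_carrier]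
  by (simp add: adjacency_eigenvalues_def eigenvalue_root_char_poly[OF adjacency_matrix_carrier])

lemma eigenvector_one:
  assumes "pverts G \<noteq> {}"
  shows "eigenvector (adjacency_matrix G) (vec n (\<lambda>_. 1)) (real d)"
  using eigenvector_adjacency_matrix[of "\<lambda>_. 1" "real d"] assms
  by (auto simp: kernel_op_def adjacency_row_sum)

text \<open>The constant vector realizes \<open>d\<close>, and the row-sum bound excludes anything
  larger. This identifies the copy that is exempt from the bound by \<open>lam\<close>.\<close>

lemma Max_adjacency_eigenvalues:
  assumes "pverts G \<noteq> {}"
  shows "Max_mset (adjacency_eigenvalues G) = real d"
proof (rule Max_eqI)
  show "real d \<in># adjacency_eigenvalues G"
    using eigenvector_one[OF assms] by (auto simp: in_adjacency_eigenvalues_iff eigenvalue_def)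
  fix k assume "k \<in># adjacency_eigenvalues G"
  then have "\<bar>k\<bar> \<le> real d"
    unfolding in_adjacency_eigenvalues_iff
  proof (rule abs_eigenvalue_le_row_sum[OF adjacency_matrix_carrier, rotated -1])
    fix i assume i: "i < n"
    show "0 \<le> adjacency_matrix G $$ (i, j)" if "j < n" for j
      using i that by (simp add: adjacency_matrix_index adjacency_def)
    have "(\<Sum>j<n. adjacency_matrix G $$ (i, j)) =
        (\<Sum>j<n. adjacency G (vertex_enum G ! i) (vertex_enum G ! j))"
      using i by (simp add: adjacency_matrix_index)
    then show "(\<Sum>j<n. adjacency_matrix G $$ (i, j)) = real d"
      using i by (simp add: sum_vertex_enum adjacency_row_sum vertex_enum_nth)
  qed
  then show "k \<le> real d" by simp
qed simp

text \<open>Removing one copy of \<open>d\<close> leaves a copy of \<open>k\<close>: if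
  \<open>k\<close> differs from \<open>d\<close>, none of its copies is removed; otherwise
  \<open>x\<close> and the constant vector are independent eigenvectors, so there are at least two
  copies.\<close>

lemma abs_balanced_eigenvalue_le:
  assumes nz: "\<exists>v\<in>pverts G. x v \<noteq> 0" and x0: "(\<Sum>v\<in>pverts G. x v) = 0"
    and ev: "\<And>v. v \<in> pverts G \<Longrightarrow> kernel_op (pverts G) (adjacency G) x v = k * x v"
  shows "\<bar>k\<bar> \<le> lam"
proof -
  let ?x = "vec n (\<lambda>i. x (vertex_enum G ! i))"
  have ne: "pverts G \<noteq> {}" using nz by auto
  have evx: "eigenvector (adjacency_matrix G) ?x k"
    by (rule eigenvector_adjacency_matrix[OF nz ev])
  have "2 \<le> order k (char_poly (adjacency_matrix G))" if "k = real d"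
  proof (rule two_le_order_char_poly[OF adjacency_matrix_carrier _ evx])
    show "eigenvector (adjacency_matrix G) (vec n (\<lambda>_. 1)) k"
      using eigenvector_one[OF ne] that by simp
    fix a b assume 0: "a \<cdot>\<^sub>v vec n (\<lambda>_. 1) + b \<cdot>\<^sub>v ?x = 0\<^sub>v n"
    have "a + b * x (vertex_enum G ! i) = 0" if "i < n" for i
      using arg_cong[OF 0, of "\<lambda>u. u $ i"] that by simp
    then have ab: "a + b * x v = 0" if "v \<in> pverts G" for v
      using that by (metis in_set_conv_nth set_vertex_enum length_vertex_enum)
    \<comment> \<open>Summing over all vertices cancels the \<open>x\<close> term and leaves
      \<open>n * a = 0\<close>.\<close>
    then have "(\<Sum>v\<in>pverts G. a + b * x v) = 0" by simp
    then have "a = 0"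
      using x0 ne pair_finite_verts by (simp add: sum.distrib flip: sum_distrib_left)
    then show "b = 0" using ab nz by auto
  qed
  moreover have "1 \<le> order k (char_poly (adjacency_matrix G))"
    using evx in_adjacency_eigenvalues_iff[of k]
    by (auto simp: eigenvalue_def Suc_le_eq simp flip: count_adjacency_eigenvalues)
  ultimately have "0 < count (adjacency_eigenvalues G - {#Max_mset (adjacency_eigenvalues G)#}) k"
    by (auto simp: Max_adjacency_eigenvalues[OF ne] count_adjacency_eigenvalues)
  then show ?thesis
    by (intro eigenvalue_bound) (simp only: count_greater_zero_iff)
qed

text \<open>The operator norm on sum-zero functions is the absolute value of an eigenvalue to which
  the bound by \<open>lam\<close> applies. With two vertices such an eigenvalue exists, which also
  forces \<open>lam\<close> to be nonnegative.\<close>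

lemma balanced_norm_bound:
  assumes "2 \<le> n"
  shows "0 \<le> lam"
    and "(\<Sum>v\<in>pverts G. y v) = 0 \<Longrightarrow>
      (\<Sum>v\<in>pverts G. (kernel_op (pverts G) (adjacency G) y v)\<^sup>2) \<le> lam\<^sup>2 * (\<Sum>v\<in>pverts G. (y v)\<^sup>2)"
proof -
  have "2 \<le> card (pverts G)" using assms card_verts by simp
  then obtain x k where "\<exists>v\<in>pverts G. x v \<noteq> 0" "(\<Sum>v\<in>pverts G. x v) = 0"
      "\<And>v. v \<in> pverts G \<Longrightarrow> kernel_op (pverts G) (adjacency G) x v = k * x v"
    and bound: "\<And>y. (\<Sum>v\<in>pverts G. y v) = 0 \<Longrightarrow>
      (\<Sum>v\<in>pverts G. (kernel_op (pverts G) (adjacency G) y v)\<^sup>2) \<le> k\<^sup>2 * (\<Sum>v\<in>pverts G. (y v)\<^sup>2)"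
    using ex_extremal_balanced_eigenvector[OF pair_finite_verts _ adjacency_sym adjacency_row_sum] by metis
  then have k: "\<bar>k\<bar> \<le> lam" by (intro abs_balanced_eigenvalue_le)
  then show "0 \<le> lam" by linarith
  assume "(\<Sum>v\<in>pverts G. y v) = 0"
  note bound[OF this]
  also have "k\<^sup>2 * (\<Sum>v\<in>pverts G. (y v)\<^sup>2) \<le> lam\<^sup>2 * (\<Sum>v\<in>pverts G. (y v)\<^sup>2)"
    using k by (intro mult_right_mono sum_nonneg) (auto simp: abs_le_square_iff[symmetric])
  finally show "(\<Sum>v\<in>pverts G. (kernel_op (pverts G) (adjacency G) y v)\<^sup>2) \<le> lam\<^sup>2 * (\<Sum>v\<in>pverts G. (y v)\<^sup>2)" .
qed

section \<open>Counting paths and estimating the deviation\<close>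

text \<open>Triples are grouped by their middle vertex; the two endpoints are then chosen
  independently among its neighbours in \<open>E\<close>.\<close>

lemma p2_eq_sum_degree_squares:
  assumes "E \<subseteq> pverts G"
  shows "real (p2 G E) = (\<Sum>v\<in>E. (\<Sum>w\<in>E. adjacency G v w)\<^sup>2)"
proof -
  let ?N = "\<lambda>v. {w \<in> E. (v, w) \<in> parcs G}"
  have fin: "finite E" using finite_subset[OF assms pair_finite_verts] .
  have sym: "(u, v) \<in> parcs G \<longleftrightarrow> (v, u) \<in> parcs G" for u v
    using adjacency_sym[of u v] by (simp add: adjacency_def of_bool_def split: if_splits)
  have "bij_betw (\<lambda>(v, u, w). (u, v, w)) (SIGMA v:E. ?N v \<times> ?N v)
      {(u, v, w). u \<in> E \<and> v \<in> E \<and> w \<in> E \<and> (u, v) \<in> parcs G \<and> (v, w) \<in> parcs G}"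
    by (rule bij_betw_byWitness[where f' = "\<lambda>(u, v, w). (v, u, w)"]) (use sym in auto)
  then have "p2 G E = card (SIGMA v:E. ?N v \<times> ?N v)"
    unfolding p2_def by (simp add: bij_betw_same_card)
  also have "\<dots> = (\<Sum>v\<in>E. (card (?N v))\<^sup>2)"
    using fin by (simp add: card_cartesian_product power2_eq_square)
  finally show ?thesis
    by (simp add: sum_adjacency[OF assms])
qed

lemma p2_deviation:
  assumes E: "E \<subseteq> pverts G"
  shows "\<bar>real (p2 G E) - (real d / real n)\<^sup>2 * real (card E) ^ 3\<bar>
    \<le> 2 * (lam * real d / real n) * (real (card E))\<^sup>2 + lam\<^sup>2 * real (card E)"
proof (cases "2 \<le> n")
  \<comment> \<open>With at most one vertex, no eigenvalue remains after the exempt one, so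
    \<open>lam\<close> may be negative and this case is treated directly.\<close>
  case False
  have no_arcs: "parcs G = {}"
  proof (rule ccontr)
    assume "parcs G \<noteq> {}"
    then obtain e where e: "e \<in> parcs G" by auto
    then have "{fst e, snd e} \<subseteq> pverts G" "fst e \<noteq> snd e"
      using arc_fst_in_verts arc_snd_in_verts pair_no_loops by auto
    then show False
      using False card_mono[OF pair_finite_verts, of "{fst e, snd e}"] card_verts by auto
  qed
  \<comment> \<open>For \<open>n = 0\<close> the degree \<open>d\<close> is arbitrary, but a
    quotient by zero is 0. Either way only the nonnegative term
    \<open>lam\<^sup>2 * real (card E)\<close> survives.\<close>
  have "d = 0 \<or> n = 0"
  proof (cases "pverts G = {}")
    case False
    then obtain v where "v \<in> pverts G" by auto
    from regular[OF this] show ?thesis by (simp add: out_degree_def out_arcs_def no_arcs)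
  qed (use card_verts in simp)
  moreover have "p2 G E = 0"
    by (simp add: p2_def no_arcs case_prod_unfold)
  ultimately show ?thesis by auto
next
  case True
  let ?V = "pverts G"
  let ?A = "kernel_op ?V (adjacency G)"
  define m where "m = real (card E)"
  define y :: "'a \<Rightarrow> real" where "y v = of_bool (v \<in> E) - m / n" for v
  \<comment> \<open>The image of the constant part \<open>m / n\<close> of the indicator: the
    average number of neighbours in \<open>E\<close> over all vertices.\<close>
  define c where "c = d * m / n"
  have fin: "finite E" using finite_subset[OF E pair_finite_verts] .
  have n: "real n > 0" using True by simp
  have sumE: "(\<Sum>v\<in>?V. of_bool (v \<in> E) :: real) = m"
    using E pair_finite_verts by (simp add: m_def Int_absorb1)
  have y0: "(\<Sum>v\<in>?V. y v) = 0"
    using n by (simp add: y_def sum_subtractf sumE card_verts)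
  have "(\<Sum>v\<in>?V. (y v)\<^sup>2) = (\<Sum>v\<in>?V. of_bool (v \<in> E) * (1 - 2 * m / n) + (m / n)\<^sup>2)"
    by (intro sum.cong refl) (simp add: y_def power2_eq_square algebra_simps)
  also have "\<dots> = m - m\<^sup>2 / n"
    using n by (simp add: sum.distrib sumE card_verts flip: sum_distrib_right)
      (simp add: field_simps power2_eq_square)
  also have "\<dots> \<le> m" using n by simp
  finally have y2: "(\<Sum>v\<in>?V. (y v)\<^sup>2) \<le> m" .
  have deg: "(\<Sum>w\<in>E. adjacency G v w) = c + ?A y v" if "v \<in> ?V" for v
  proof -
    have "?A y v = (\<Sum>w\<in>?V. adjacency G v w * of_bool (w \<in> E)) - (\<Sum>w\<in>?V. adjacency G v w) * (m / n)"
      unfolding kernel_op_def sum_distrib_right sum_subtractf[symmetric]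
      by (intro sum.cong refl) (simp add: y_def right_diff_distrib)
    also have "(\<Sum>w\<in>?V. adjacency G v w * of_bool (w \<in> E)) = (\<Sum>w\<in>E. adjacency G v w)"
      using E pair_finite_verts by (intro sum.mono_neutral_cong_right) auto
    finally show ?thesis by (simp add: adjacency_row_sum[OF that] c_def)
  qed
  \<comment> \<open>The norm bound concerns sums over all vertices; enlarging \<open>E\<close> to
    \<open>?V\<close> only adds squares.\<close>
  have "(\<Sum>v\<in>E. (?A y v)\<^sup>2) \<le> (\<Sum>v\<in>?V. (?A y v)\<^sup>2)"
    using E pair_finite_verts by (intro sum_mono2) auto
  also have "\<dots> \<le> lam\<^sup>2 * (\<Sum>v\<in>?V. (y v)\<^sup>2)"
    by (rule balanced_norm_bound(2)[OF True y0])
  also have "\<dots> \<le> lam\<^sup>2 * m"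
    using y2 by (intro mult_left_mono) auto
  finally have sq: "(\<Sum>v\<in>E. (?A y v)\<^sup>2) \<le> lam\<^sup>2 * m" .
  \<comment> \<open>Cauchy-Schwarz against the constant 1 on \<open>E\<close>. Taking square roots
    afterwards uses that \<open>lam\<close> is nonnegative.\<close>
  have "(\<Sum>v\<in>E. ?A y v)\<^sup>2 \<le> (\<Sum>v\<in>E. (?A y v)\<^sup>2) * m"
    unfolding m_def by (rule sum_squared_le_sum_of_squares)
  also have "\<dots> \<le> lam\<^sup>2 * m * m"
    using sq by (intro mult_right_mono) (auto simp: m_def)
  finally have "(\<Sum>v\<in>E. ?A y v)\<^sup>2 \<le> (lam * m)\<^sup>2"
    by (simp add: power2_eq_square mult_ac)
  then have lin: "\<bar>\<Sum>v\<in>E. ?A y v\<bar> \<le> lam * m"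
    using balanced_norm_bound(1)[OF True] by (simp add: m_def abs_le_square_iff[symmetric] abs_mult)
  have "c \<ge> 0" by (simp add: c_def m_def)
  have "real (p2 G E) = (\<Sum>v\<in>E. (c + ?A y v)\<^sup>2)"
    unfolding p2_eq_sum_degree_squares[OF E] using E deg by (intro sum.cong) auto
  also have "\<dots> = m * c\<^sup>2 + 2 * c * (\<Sum>v\<in>E. ?A y v) + (\<Sum>v\<in>E. (?A y v)\<^sup>2)"
    by (simp add: power2_sum sum.distrib m_def mult_ac flip: sum_distrib_left)
  also have "m * c\<^sup>2 = (real d / real n)\<^sup>2 * m ^ 3"
    by (simp add: c_def power2_eq_square power3_eq_cube)
  finally have "\<bar>real (p2 G E) - (real d / real n)\<^sup>2 * m ^ 3\<bar>
      = \<bar>2 * c * (\<Sum>v\<in>E. ?A y v) + (\<Sum>v\<in>E. (?A y v)\<^sup>2)\<bar>" by simp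
  also have "\<dots> \<le> 2 * c * \<bar>\<Sum>v\<in>E. ?A y v\<bar> + (\<Sum>v\<in>E. (?A y v)\<^sup>2)"
    using \<open>c \<ge> 0\<close> by (intro abs_triangle_ineq[THEN order_trans]) (simp add: abs_mult sum_nonneg)
  \<comment> \<open>As \<open>c\<close> is proportional to \<open>m\<close>, the cross term yields
    the error quadratic in the size of \<open>E\<close>, and the sum of squares yields the linear
    one.\<close>
  also have "\<dots> \<le> 2 * c * (lam * m) + lam\<^sup>2 * m"
    using \<open>c \<ge> 0\<close> lin sq by (intro add_mono mult_left_mono) auto
  also have "2 * c * (lam * m) = 2 * (lam * real d / real n) * m\<^sup>2"
    by (simp add: c_def power2_eq_square)
  finally show ?thesis unfolding m_def .
qed

end

section \<open>The uniform bound and the asymptotic count\<close>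

theorem theorem6:
  shows "(\<forall>(G :: 'a pair_pre_digraph) (n :: nat) (d :: nat) (lam :: real) (E :: 'a set).
            ndl_graph G n d lam \<and> E \<subseteq> pverts G \<longrightarrow>
            \<bar>real (p2 G E) - (real d / real n)\<^sup>2 * real (card E) ^ 3\<bar>
              \<le> 2 * (lam * real d / real n) * (real (card E))\<^sup>2 + lam\<^sup>2 * real (card E))
       \<and> (\<forall>(G :: nat \<Rightarrow> 'a pair_pre_digraph) (n :: nat \<Rightarrow> nat) (d :: nat \<Rightarrow> nat)
             (lam :: nat \<Rightarrow> real) (E :: nat \<Rightarrow> 'a set).
            (\<forall>k. ndl_graph (G k) (n k) (d k) (lam k) \<and> E k \<subseteq> pverts (G k)) \<and>
            filterlim (\<lambda>k. real (card (E k)) * real (d k) / (lam k * real (n k))) at_top sequentially \<longrightarrow>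
            (\<lambda>k. real (p2 (G k) (E k)))
              \<sim>[sequentially] (\<lambda>k. real (card (E k)) ^ 3 * (real (d k) / real (n k))\<^sup>2))"
proof (intro conjI allI impI; elim conjE)
  fix G :: "'a pair_pre_digraph" and n d lam E
  assume "ndl_graph G n d lam" "E \<subseteq> pverts G"
  then show "\<bar>real (p2 G E) - (real d / real n)\<^sup>2 * real (card E) ^ 3\<bar>
      \<le> 2 * (lam * real d / real n) * (real (card E))\<^sup>2 + lam\<^sup>2 * real (card E)"
    by (rule ndl_graph.p2_deviation)
next
  fix G :: "nat \<Rightarrow> 'a pair_pre_digraph" and n d lam and E :: "nat \<Rightarrow> 'a set"
  assume G: "\<forall>k. ndl_graph (G k) (n k) (d k) (lam k) \<and> E k \<subseteq> pverts (G k)"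
    and lim: "filterlim (\<lambda>k. real (card (E k)) * real (d k) / (lam k * real (n k))) at_top sequentially"
  \<comment> \<open>Relative to the main term \<open>M k\<close>, the two errors are exactly
    \<open>2 / q k\<close> and \<open>1 / (q k)\<^sup>2\<close>.\<close>
  define q where "q k = real (card (E k)) * real (d k) / (lam k * real (n k))" for k
  define M where "M k = real (card (E k)) ^ 3 * (real (d k) / real (n k))\<^sup>2" for k
  have q: "filterlim q at_top sequentially"
    using lim unfolding q_def .
  have pos: "eventually (\<lambda>k. q k > 0) sequentially"
    using q by (simp add: filterlim_at_top_dense)
  \<comment> \<open>Division by zero gives 0, so positivity of \<open>q k\<close> excludes vanishing
    denominators as well as vanishing numerators.\<close>
  have nz: "card (E k) \<noteq> 0 \<and> d k \<noteq> 0 \<and> lam k \<noteq> 0 \<and> n k \<noteq> 0" if "q k > 0" for k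
    using that unfolding q_def by (intro conjI notI) simp_all
  have "(\<lambda>k. real (p2 (G k) (E k)) / M k - 1) \<longlonglongrightarrow> 0"
  proof (rule tendsto_0_le)
    have "(\<lambda>k. inverse (q k)) \<longlonglongrightarrow> 0"
      using q by (rule tendsto_inverse_0_at_top)
    then have "(\<lambda>k. 2 * inverse (q k) + (inverse (q k))\<^sup>2) \<longlonglongrightarrow> 2 * 0 + 0\<^sup>2"
      by (intro tendsto_intros)
    then show "(\<lambda>k. 2 * inverse (q k) + (inverse (q k))\<^sup>2) \<longlonglongrightarrow> 0" by simp
    show "eventually (\<lambda>k. norm (real (p2 (G k) (E k)) / M k - 1)
        \<le> norm (2 * inverse (q k) + (inverse (q k))\<^sup>2) * 1) sequentially"
      using pos
    proof eventually_elim
      case (elim k)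
      note nz = nz[OF elim]
      have "M k > 0" using nz by (simp add: M_def)
      have "\<bar>real (p2 (G k) (E k)) - M k\<bar>
          \<le> 2 * (lam k * real (d k) / real (n k)) * (real (card (E k)))\<^sup>2 + (lam k)\<^sup>2 * real (card (E k))"
        using ndl_graph.p2_deviation[of "G k" "n k" "d k" "lam k" "E k"] G by (simp add: M_def mult.commute)
      also have "\<dots> = (2 * inverse (q k) + (inverse (q k))\<^sup>2) * M k"
        using nz by (simp add: q_def M_def field_simps power2_eq_square power3_eq_cube)
      finally have "\<bar>real (p2 (G k) (E k)) / M k - 1\<bar> \<le> 2 * inverse (q k) + (inverse (q k))\<^sup>2"
        using \<open>M k > 0\<close> abs_divide[of "real (p2 (G k) (E k)) - M k" "M k"]
        by (simp add: diff_divide_distrib pos_divide_le_eq)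
      then show ?case
        by simp
    qed
  qed
  then have "(\<lambda>k. real (p2 (G k) (E k)) / M k) \<longlonglongrightarrow> 1"
    by (simp add: LIM_zero_cancel)
  then show "(\<lambda>k. real (p2 (G k) (E k)))
      \<sim>[sequentially] (\<lambda>k. real (card (E k)) ^ 3 * (real (d k) / real (n k))\<^sup>2)"
    unfolding M_def by (rule asymp_equivI')
qed

end
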